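(* Let $$\begin{aligned}Q_1&=\{7,11,13,17,19,29,71,83\},\\ Q_2&=\{7,11,13,17,19,23,83,179\},\\ Q_3&=\{7,11,13,17,19,29,41,503\},\\ Q_4&=\{7,11,13,17,19,23,59,1259\}.\end{aligned}$$ Each of the prime sets $Q_i$ $(1\le i\le 4)$ satisfies $\sum_{q\in Q_i}\frac{1}{q+1}=\frac49$. Consequently, for every $1\le i\le 4$, the group $$A_5\times C_2\times\prod_{q\in Q_i}C_q$$ is a nonsolvable group, not isomorphic to $A_5$, with $\gamma\Big(A_5\times C_2\times\prod_{q\in Q_i}C_q\Big)=\frac92$.
   Context: $C_n$ denotes the cyclic group of order $n$ and $A_5$ the alternating group of degree $5$. For a finite group $G$, $\pi(G)$ is the set of primes dividing $|G|$; for $p\in\pi(G)$, $\nu_p(G)$ is the number of Sylow $p$-subgroups of $G$ and $\sigma_p(G)$ is their common order. The Sylow-integral invariant is $$\gamma(G)=\int_0^1\sum_{p\in\pi(G)}\nu_p(G)x^{\sigma_p(G)}\,dx=\sum_{p\in\pi(G)}\frac{\nu_p(G)}{\sigma_p(G)+1}.$$ *)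

theory Defs
  imports "HOL-Algebra.Sylow" "HOL-Algebra.Sym_Groups" "HOL-Algebra.Product_Groups"
    "HOL-Analysis.Analysis"
begin

definition prime_divisors_of_order :: "('a, 'b) monoid_scheme \<Rightarrow> nat set" where
  "prime_divisors_of_order G = {p. prime p \<and> p dvd Coset.order G}"

definition sylow_order :: "('a, 'b) monoid_scheme \<Rightarrow> nat \<Rightarrow> nat" where
  "sylow_order G p = p ^ multiplicity p (Coset.order G)"

definition sylow_subgroups :: "('a, 'b) monoid_scheme \<Rightarrow> nat \<Rightarrow> 'a set set" where
  "sylow_subgroups G p = {H. subgroup H G \<and> card H = sylow_order G p}"

definition sylow_number :: "('a, 'b) monoid_scheme \<Rightarrow> nat \<Rightarrow> nat" where
  "sylow_number G p = card (sylow_subgroups G p)"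

text \<open>The invariant is meaningful only for finite groups: an infinite carrier has
  \<^term>\<open>Coset.order G = 0\<close>, and then the index set of the sum is infinite.\<close>

definition sylow_gamma :: "('a, 'b) monoid_scheme \<Rightarrow> real" where
  "sylow_gamma G =
     integral {0..1}
       (\<lambda>x::real. \<Sum>p\<in>prime_divisors_of_order G. real (sylow_number G p) * x ^ sylow_order G p)"

lemma sylow_gamma_eq_sum:
  "sylow_gamma G =
     (\<Sum>p\<in>prime_divisors_of_order G. real (sylow_number G p) / (real (sylow_order G p) + 1))"
proof (cases "finite (prime_divisors_of_order G)")
  case True
  have mono: "((\<lambda>x::real. x ^ n) has_integral 1 / (real n + 1)) {0..1}" for n :: nat
  proof -
    have "((\<lambda>x::real. x ^ n) has_integral 1 ^ Suc n / real (Suc n) - 0 ^ Suc n / real (Suc n)) {0..1}"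
    proof (rule fundamental_theorem_of_calculus)
      fix x :: real
      have "((\<lambda>x. x ^ Suc n / real (Suc n)) has_real_derivative x ^ n) (at x within {0..1})"
        using DERIV_cdivide[OF DERIV_pow[of "Suc n" x "{0..1}"], of "real (Suc n)"]
        by (simp del: of_nat_Suc power_Suc)
      then show "((\<lambda>x. x ^ Suc n / real (Suc n)) has_vector_derivative x ^ n) (at x within {0..1})"
        by (simp only: has_real_derivative_iff_has_vector_derivative)
    qed simp
    then show ?thesis by (simp add: add.commute)
  qed
  have "((\<lambda>x::real. \<Sum>p\<in>prime_divisors_of_order G. real (sylow_number G p) * x ^ sylow_order G p)
      has_integral
        (\<Sum>p\<in>prime_divisors_of_order G. real (sylow_number G p) * (1 / (real (sylow_order G p) + 1))))
      {0..1}"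
    by (intro has_integral_sum True has_integral_mult_right mono)
  then show ?thesis
    unfolding sylow_gamma_def by (simp add: integral_unique)
qed (simp add: sylow_gamma_def)

text \<open>For \<open>n \<ge> 1\<close>, \<^term>\<open>integer_mod_group n\<close> is the additive group of residues modulo
  \<open>n\<close>, and so the cyclic group of order \<open>n\<close>.\<close>

definition A5_C2_prod :: "nat set \<Rightarrow> ((nat \<Rightarrow> nat) \<times> int \<times> (nat \<Rightarrow> int)) monoid" where
  "A5_C2_prod Q = alt_group 5 \<times>\<times> integer_mod_group 2 \<times>\<times> product_group Q integer_mod_group"

end

theory Submission
  imports Defs "HOL-Algebra.Multiplicative_Group"
begin

text \<open>The Sylow number \<open>\<nu>\<^sub>p\<close> and the Sylow order \<open>\<sigma>\<^sub>p\<close> are multiplicative on direct products of finite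
  groups, and \<open>\<nu>\<^sub>p = 1\<close> for abelian groups.  Hence the factor \<open>C\<^sub>2 \<times> \<Prod> C\<^sub>q\<close> leaves the Sylow numbers of
  \<open>A\<^sub>5\<close> unchanged.  It doubles \<open>\<sigma>\<^sub>2\<close> from 4 to 8, keeps \<open>\<sigma>\<^sub>3 = 3\<close> and \<open>\<sigma>\<^sub>5 = 5\<close>, and adds one Sylow
  subgroup of order \<open>q\<close> for each \<open>q \<in> Q\<close> if the elements of \<open>Q\<close> are primes above 5.  With
  \<open>\<nu>\<^sub>2 = 5, \<nu>\<^sub>3 = 10, \<nu>\<^sub>5 = 6\<close> for \<open>A\<^sub>5\<close> this gives
  \<open>\<gamma> = 5/9 + 10/4 + 6/6 + \<Sum> 1/(q+1) = 73/18 + \<Sum> 1/(q+1)\<close>, and \<open>73/18 + 4/9 = 9/2\<close>.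

  The Sylow numbers of \<open>A\<^sub>5\<close> rest on a property of this group: for \<open>q = 4, 3, 5\<close>, the centralizer of
  an element \<open>x \<noteq> 1\<close> with \<open>x\<^sup>q = 1\<close> has exactly \<open>q\<close> elements.  A group of order at most 5 is abelian,
  so this centralizer is the only subgroup of order \<open>q\<close> through \<open>x\<close>, and the subgroups of order \<open>q\<close>
  partition the 15, 20 and 24 elements in question into blocks of size \<open>q - 1\<close>:
  \<open>15/3 = 5\<close>, \<open>20/2 = 10\<close>, \<open>24/4 = 6\<close>.  The sizes of the centralizers and the three counts are
  computed in an explicit list of the 60 elements.\<close>

section \<open>Counting subgroups of a fixed order\<close>

text \<open>If \<open>x\<close> and \<open>y\<close> do not commute, then \<open>1, x, y, xy, yx\<close> are five different elements.
  A sixth one is \<open>x\<^sup>2\<close>, or \<open>xyx\<close> if \<open>x\<^sup>2 = 1\<close>.\<close>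
lemma (in group) commute_of_order_le_5:
  assumes fin: "finite (carrier G)" and le: "Coset.order G \<le> 5"
    and x: "x \<in> carrier G" and y: "y \<in> carrier G"
  shows "x \<otimes> y = y \<otimes> x"
proof (rule ccontr)
  assume ne: "x \<otimes> y \<noteq> y \<otimes> x"
  have five: "x \<noteq> \<one>" "y \<noteq> \<one>" "x \<noteq> y" "x \<otimes> y \<noteq> \<one>" "y \<otimes> x \<noteq> \<one>"
    "x \<otimes> y \<noteq> x" "x \<otimes> y \<noteq> y" "y \<otimes> x \<noteq> x" "y \<otimes> x \<noteq> y"
    using ne x y inv_comm[OF _ x y] inv_comm[OF _ y x] by auto
  define z where "z = (if x \<otimes> x = \<one> then x \<otimes> y \<otimes> x else x \<otimes> x)"
  have z: "z \<in> carrier G" using x y by (simp add: z_def)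
  have six: "z \<notin> {\<one>, x, y, x \<otimes> y, y \<otimes> x}"
  proof (cases "x \<otimes> x = \<one>")
    case True
    \<comment> \<open>Multiplication by the involution \<open>x\<close> takes \<open>xyx\<close> to \<open>yx\<close>, which is known to differ from
      \<open>x, 1, xy, y\<close>; and \<open>xyx = yx\<close> would give \<open>xy = y\<close> by cancellation.\<close>
    have xz: "x \<otimes> (x \<otimes> y \<otimes> x) = y \<otimes> x"
      using x y True by (metis l_one m_assoc m_closed)
    have "x \<otimes> z \<notin> {x, \<one>, x \<otimes> y, y, x \<otimes> (y \<otimes> x)}"
      using five ne x y True xz by (auto simp: z_def m_assoc)
    moreover have "x \<otimes> (x \<otimes> y) = y"
      using x y True by (metis l_one m_assoc)
    ultimately show ?thesis using True x by auto
  next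
    case False
    have "x \<otimes> x \<noteq> y" using ne x by (auto simp: m_assoc)
    then show ?thesis using five ne x y False by (auto simp: z_def)
  qed
  define S where "S = {z, \<one>, x, y, x \<otimes> y, y \<otimes> x}"
  have "card S = 6"
    unfolding S_def using six five ne by auto
  moreover have "S \<subseteq> carrier G"
    unfolding S_def using x y z by auto
  then have "card S \<le> Coset.order G"
    unfolding Coset.order_def by (rule card_mono[OF fin])
  ultimately have "6 \<le> Coset.order G" by simp
  with le show False by simp
qed

lemma (in group) pow_card_subgroup:
  assumes "subgroup H G" "x \<in> H"
  shows "x [^] card H = \<one>"
proof -
  have H: "group (G\<lparr>carrier := H\<rparr>)"
    by (rule subgroup.subgroup_is_group[OF assms(1) is_group])
  have "x [^]\<^bsub>G\<lparr>carrier := H\<rparr>\<^esub> Coset.order (G\<lparr>carrier := H\<rparr>) = \<one>"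
    using group.pow_order_eq_1[OF H, of x] assms(2) by simp
  then show ?thesis by (simp add: Coset.order_def flip: nat_pow_consistent)
qed

text \<open>The centralizer of an element \<open>x \<noteq> 1\<close> with \<open>x\<^sup>q = 1\<close> is a subgroup with \<open>q\<close> elements.  It is
  the only subgroup of order \<open>q\<close> that contains \<open>x\<close>: such a subgroup is abelian, hence lies in the
  centralizer, and has the same size.  So the subgroups of order \<open>q\<close>, without their unit, partition
  the set of these elements into blocks of size \<open>q - 1\<close>.\<close>
lemma (in group) card_subgroups_via_centralizers:
  assumes fin: "finite (carrier G)"
    and comm: "\<And>H x y. \<lbrakk>subgroup H G; card H = q; x \<in> H; y \<in> H\<rbrakk> \<Longrightarrow> x \<otimes> y = y \<otimes> x"
    and cent: "\<And>x. \<lbrakk>x \<in> carrier G; x \<noteq> \<one>; x [^] q = \<one>\<rbrakk>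
      \<Longrightarrow> card {y \<in> carrier G. x \<otimes> y = y \<otimes> x} = q"
  shows "(q - 1) * card {H. subgroup H G \<and> card H = q}
    = card {x \<in> carrier G. x \<noteq> \<one> \<and> x [^] q = \<one>}"
proof -
  let ?S = "{H. subgroup H G \<and> card H = q}"
  let ?C = "\<lambda>x. {y \<in> carrier G. x \<otimes> y = y \<otimes> x}"
  have subC: "subgroup (?C x) G" if x: "x \<in> carrier G" for x
  proof (rule subgroupI)
    fix a assume a: "a \<in> ?C x"
    then have a': "a \<in> carrier G" "x \<otimes> a = a \<otimes> x" by auto
    have "x \<otimes> inv a = inv a \<otimes> a \<otimes> (x \<otimes> inv a)" using a' x by simp
    also have "\<dots> = inv a \<otimes> (a \<otimes> x) \<otimes> inv a"
      using a' x by (simp only: m_assoc m_closed inv_closed)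
    also have "\<dots> = inv a \<otimes> (x \<otimes> a) \<otimes> inv a" using a' by simp
    also have "\<dots> = inv a \<otimes> x \<otimes> (a \<otimes> inv a)"
      using a'(1) x by (simp only: m_assoc m_closed inv_closed)
    also have "\<dots> = inv a \<otimes> x" using a' x by simp
    finally have "x \<otimes> inv a = inv a \<otimes> x" .
    then show "inv a \<in> ?C x" using a' by simp
  next
    fix a b assume "a \<in> ?C x" "b \<in> ?C x"
    then show "a \<otimes> b \<in> ?C x" using x by simp (metis m_assoc)
  qed (use x in auto)
  have HC: "H = ?C x" and pw: "x [^] q = \<one>" if "H \<in> ?S" "x \<in> H" "x \<noteq> \<one>" for H x
  proof -
    have H: "subgroup H G" "card H = q" using that by auto
    have x: "x \<in> carrier G" using subgroup.mem_carrier[OF H(1) that(2)] .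
    show pw: "x [^] q = \<one>" using pow_card_subgroup[OF H(1) that(2)] H(2) by simp
    have "H \<subseteq> ?C x" using comm[OF H that(2)] subgroup.mem_carrier[OF H(1)] by auto
    then show "H = ?C x"
      using cent[OF x that(3) pw] H(2) fin by (intro card_subset_eq) auto
  qed
  have finS: "finite ?S"
    using fin by (intro finite_subset[of ?S "Pow (carrier G)"]) (auto dest: subgroup.subset)
  have "{x \<in> carrier G. x \<noteq> \<one> \<and> x [^] q = \<one>} = (\<Union>H\<in>?S. H - {\<one>})"
  proof (intro equalityI subsetI)
    fix x assume "x \<in> {x \<in> carrier G. x \<noteq> \<one> \<and> x [^] q = \<one>}"
    then have "?C x \<in> ?S" "x \<in> ?C x - {\<one>}" using subC cent by auto
    then show "x \<in> (\<Union>H\<in>?S. H - {\<one>})" by (rule UN_I)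
  next
    fix x assume "x \<in> (\<Union>H\<in>?S. H - {\<one>})"
    then obtain H where "H \<in> ?S" "x \<in> H" "x \<noteq> \<one>" by blast
    then show "x \<in> {x \<in> carrier G. x \<noteq> \<one> \<and> x [^] q = \<one>}"
      using pw[of H x] by (auto dest: subgroup.mem_carrier)
  qed
  moreover have "card (\<Union>H\<in>?S. H - {\<one>}) = (\<Sum>H\<in>?S. card (H - {\<one>}))"
  proof (rule card_UN_disjoint[OF finS])
    show "\<forall>H\<in>?S. finite (H - {\<one>})"
      using fin by (auto dest: subgroup.subset intro: finite_subset)
    show "\<forall>H\<in>?S. \<forall>K\<in>?S. H \<noteq> K \<longrightarrow> (H - {\<one>}) \<inter> (K - {\<one>}) = {}"
      using HC by blast
  qed
  moreover have "card (H - {\<one>}) = q - 1" if "H \<in> ?S" for H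
    using that by (simp add: subgroup.one_closed)
  ultimately show ?thesis by simp
qed

section \<open>Sylow subgroups of abelian groups and of direct products\<close>

text \<open>The image of \<open>P\<close> is isomorphic to the quotient of \<open>P\<close> by the kernel of the restricted
  homomorphism.\<close>
lemma card_hom_image_dvd:
  assumes "group G" "group K" and h: "h \<in> hom G K" and P: "subgroup P G"
  shows "card (h ` P) dvd card P"
proof -
  let ?P = "G\<lparr>carrier := P\<rparr>" and ?I = "K\<lparr>carrier := h ` P\<rparr>"
  have gP: "group ?P" by (rule subgroup.subgroup_is_group[OF P \<open>group G\<close>])
  have hP: "h \<in> hom ?P K"
    using h subgroup.mem_carrier[OF P] by (auto simp: hom_def Pi_iff)
  interpret k: group_hom ?P K h
    using gP \<open>group K\<close> hP by (simp add: group_hom_def group_hom_axioms_def)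
  have "group ?I"
    using subgroup.subgroup_is_group[OF k.img_is_subgroup \<open>group K\<close>] by simp
  moreover have "h \<in> hom ?P ?I" using hP by (auto simp: hom_def)
  ultimately interpret i: group_hom ?P ?I h
    using gP by (simp add: group_hom_def group_hom_axioms_def)
  have "card (rcosets\<^bsub>?P\<^esub> (kernel ?P ?I h)) = card (h ` P)"
    using iso_same_card[OF i.FactGroup_iso] by (simp add: FactGroup_def)
  then show ?thesis
    using group.lagrange[OF gP i.subgroup_kernel] by (auto simp: Coset.order_def dest: dvdI[OF sym])
qed

text \<open>The order of the image of \<open>Q\<close> in \<open>G/P\<close> divides both the power of \<open>p\<close> that is the order of \<open>Q\<close>
  and the order of \<open>G/P\<close>, which is prime to \<open>p\<close>.  So the image is trivial, that is, \<open>Q \<subseteq> P\<close>.\<close>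
lemma (in group) normal_sylow_unique:
  assumes fin: "finite (carrier G)" and p: "prime p"
    and P: "P \<in> sylow_subgroups G p" and N: "P \<lhd> G" and Q: "Q \<in> sylow_subgroups G p"
  shows "Q = P"
proof -
  interpret N: normal P G by (rule N)
  have sP: "subgroup P G" and cP: "card P = sylow_order G p"
   and sQ: "subgroup Q G" and cQ: "card Q = sylow_order G p"
    using P Q by (auto simp: sylow_subgroups_def)
  let ?\<pi> = "\<lambda>a. P #> a"
  have h: "?\<pi> \<in> hom G (G Mod P)" by (rule N.r_coset_hom_Mod)
  interpret \<pi>: group_hom G "G Mod P" ?\<pi>
    using h N.factorgroup_is_group is_group by (simp add: group_hom_def group_hom_axioms_def)
  have finQ: "finite Q" using fin sQ finite_subset subgroup.subset by blast
  have 1: "card (?\<pi> ` Q) dvd p ^ multiplicity p (Coset.order G)"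
    using card_hom_image_dvd[OF is_group N.factorgroup_is_group h sQ] cQ
    by (simp add: sylow_order_def)
  have "subgroup (?\<pi> ` Q) (G Mod P)" by (rule \<pi>.subgroup_img_is_subgroup[OF sQ])
  then have 2: "card (?\<pi> ` Q) dvd Coset.order (G Mod P)"
    using group.lagrange[OF N.factorgroup_is_group] by (metis dvd_triv_right)
  have o: "Coset.order (G Mod P) * p ^ multiplicity p (Coset.order G) = Coset.order G"
    using lagrange[OF sP] cP by (simp add: Coset.order_def FactGroup_def sylow_order_def)
  have pos: "Coset.order G > 0" using fin order_gt_0_iff_finite by blast
  have "\<not> p dvd Coset.order (G Mod P)"
  proof
    assume "p dvd Coset.order (G Mod P)"
    then have "p * p ^ multiplicity p (Coset.order G)
        dvd Coset.order (G Mod P) * p ^ multiplicity p (Coset.order G)"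
      by (rule mult_dvd_mono) simp
    then have "p ^ Suc (multiplicity p (Coset.order G)) dvd Coset.order G"
      by (simp only: o power_Suc)
    then have "Suc (multiplicity p (Coset.order G)) \<le> multiplicity p (Coset.order G)"
      using pos p by (intro multiplicity_geI) auto
    then show False by simp
  qed
  then have "coprime (p ^ multiplicity p (Coset.order G)) (Coset.order (G Mod P))"
    using p by (simp add: prime_imp_coprime)
  with 1 2 have c1: "card (?\<pi> ` Q) = 1"
    by (metis coprime_common_divisor_nat)
  have "Q \<subseteq> P"
  proof
    fix x assume x: "x \<in> Q"
    have "?\<pi> x = ?\<pi> \<one>"
      using c1 x subgroup.one_closed[OF sQ] by (metis card_1_singletonE imageI singletonD)
    then show "x \<in> P"
      using x subgroup.mem_carrier[OF sQ x] using coset_mult_one[OF N.subset] rcos_self[OF _ sP] by auto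
  qed
  then show ?thesis
    using cP cQ fin N.subset finite_subset by (intro card_subset_eq) auto
qed

lemma (in group) sylow_subgroups_nonempty:
  assumes "finite (carrier G)" "prime p"
  shows "sylow_subgroups G p \<noteq> {}"
proof -
  obtain m where "Coset.order G = p ^ multiplicity p (Coset.order G) * m"
    using multiplicity_dvd by (metis dvdE)
  from sylow_thm[OF assms(2) is_group this assms(1)] show ?thesis
    by (auto simp: sylow_subgroups_def sylow_order_def)
qed

lemma (in comm_group) sylow_number_comm_group:
  assumes "finite (carrier G)" "prime p"
  shows "sylow_number G p = 1"
proof -
  obtain P where P: "P \<in> sylow_subgroups G p"
    using sylow_subgroups_nonempty[OF assms] by blast
  then have "P \<lhd> G" by (simp add: sylow_subgroups_def normal_iff_subgroup)
  from normal_sylow_unique[OF assms P this] P have "sylow_subgroups G p = {P}" by blast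
  then show ?thesis by (simp add: sylow_number_def)
qed

lemma sylow_order_not_dvd:
  "\<not> p dvd Coset.order G \<Longrightarrow> sylow_order G p = 1"
  by (simp add: sylow_order_def not_dvd_imp_multiplicity_0)

lemma (in group) sylow_number_not_dvd:
  assumes "\<not> p dvd Coset.order G"
  shows "sylow_number G p = 1"
proof -
  have "subgroup H G \<and> card H = 1 \<longleftrightarrow> H = {\<one>}" for H
  proof
    assume H: "subgroup H G \<and> card H = 1"
    then obtain a where "H = {a}" by (metis card_1_singletonE)
    with H subgroup.one_closed[of H G] show "H = {\<one>}" by auto
  qed (auto intro: triv_subgroup)
  then have "sylow_subgroups G p = {{\<one>}}"
    by (simp only: sylow_subgroups_def sylow_order_not_dvd[OF assms] singleton_conv)
  then show ?thesis by (simp add: sylow_number_def)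
qed

lemma order_DirProd: "Coset.order (G \<times>\<times> H) = Coset.order G * Coset.order H"
  by (simp add: Coset.order_def card_cartesian_product)

lemma sylow_order_DirProd:
  assumes "group G" "finite (carrier G)" "group H" "finite (carrier H)" "prime p"
  shows "sylow_order (G \<times>\<times> H) p = sylow_order G p * sylow_order H p"
proof -
  have "Coset.order G \<noteq> 0" "Coset.order H \<noteq> 0"
    using assms by (auto simp: Coset.order_def dest: group.is_monoid monoid.carrier_not_empty)
  then show ?thesis
    using \<open>prime p\<close> by (simp add: sylow_order_def order_DirProd prime_elem_multiplicity_mult_distrib power_add)
qed

lemma card_dvd_sylow_order:
  assumes "group G" and fin: "finite (carrier G)" and p: "prime p"
    and H: "subgroup H G" and dvd: "card H dvd p ^ k"
  shows "card H dvd sylow_order G p"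
proof -
  obtain i where i: "card H = p ^ i" using dvd p divides_primepow_nat by blast
  have "card H dvd Coset.order G" using group.lagrange[OF \<open>group G\<close> H] by (metis dvd_triv_right)
  then have "i \<le> multiplicity p (Coset.order G)"
    using i fin p monoid.carrier_not_empty[OF group.is_monoid[OF \<open>group G\<close>]]
    by (intro multiplicity_geI) (auto simp: Coset.order_def)
  then show ?thesis by (simp add: i sylow_order_def le_imp_power_dvd)
qed

text \<open>The Sylow subgroups of a direct product are the products of Sylow subgroups of the factors.  The
  point is that every Sylow subgroup \<open>R\<close> is such a product: \<open>R\<close> lies in the product of its two
  projections, these are \<open>p\<close>-groups and so not larger than the Sylow subgroups of the factors, and
  the order of \<open>R\<close> is already the product of these two bounds.\<close>
lemma sylow_number_DirProd:
  assumes G: "group G" and fG: "finite (carrier G)" and H: "group H" and fH: "finite (carrier H)"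
    and p: "prime p"
  shows "sylow_number (G \<times>\<times> H) p = sylow_number G p * sylow_number H p"
proof -
  have GH: "group (G \<times>\<times> H)" by (rule DirProd_group[OF G H])
  note so = sylow_order_DirProd[OF G fG H fH p]
  have pos: "sylow_order G p > 0" "sylow_order H p > 0" "sylow_order (G \<times>\<times> H) p > 0"
    using p by (simp_all add: sylow_order_def prime_gt_0_nat)
  have "bij_betw (\<lambda>(A, B). A \<times> B) (sylow_subgroups G p \<times> sylow_subgroups H p)
          (sylow_subgroups (G \<times>\<times> H) p)"
  proof (rule bij_betw_imageI)
    show "inj_on (\<lambda>(A, B). A \<times> B) (sylow_subgroups G p \<times> sylow_subgroups H p)"
      by (auto simp: inj_on_def sylow_subgroups_def times_eq_iff dest: subgroup.one_closed)
    show "(\<lambda>(A, B). A \<times> B) ` (sylow_subgroups G p \<times> sylow_subgroups H p)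
            = sylow_subgroups (G \<times>\<times> H) p" (is "?L = ?R")
    proof (intro equalityI subsetI)
      fix R assume "R \<in> ?L"
      then show "R \<in> ?R"
        using DirProd_subgroups[OF G _ H] so
        by (auto simp: sylow_subgroups_def card_cartesian_product)
    next
      fix R assume "R \<in> ?R"
      then have R: "subgroup R (G \<times>\<times> H)" and cR: "card R = sylow_order (G \<times>\<times> H) p"
        by (auto simp: sylow_subgroups_def)
      have finR: "finite R" using cR pos by (metis card_gt_0_iff)
      have hf: "fst \<in> hom (G \<times>\<times> H) G" and hs: "snd \<in> hom (G \<times>\<times> H) H"
        by (auto simp: hom_def)
      interpret f: group_hom "G \<times>\<times> H" G fst
        using GH G hf by (simp add: group_hom_def group_hom_axioms_def)
      interpret s: group_hom "G \<times>\<times> H" H snd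
        using GH H hs by (simp add: group_hom_def group_hom_axioms_def)
      let ?A = "fst ` R" and ?B = "snd ` R"
      have A: "subgroup ?A G" and B: "subgroup ?B H"
        using f.subgroup_img_is_subgroup[OF R] s.subgroup_img_is_subgroup[OF R] .
      have "card ?A dvd sylow_order G p"
        using card_hom_image_dvd[OF GH G hf R] cR
        by (intro card_dvd_sylow_order[OF G fG p A]) (simp add: sylow_order_def)
      moreover have "card ?B dvd sylow_order H p"
        using card_hom_image_dvd[OF GH H hs R] cR
        by (intro card_dvd_sylow_order[OF H fH p B]) (simp add: sylow_order_def)
      ultimately have le: "card ?A \<le> sylow_order G p" "card ?B \<le> sylow_order H p"
        using pos dvd_imp_le by blast+
      have sub: "R \<subseteq> ?A \<times> ?B" by force
      have "card R \<le> card ?A * card ?B"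
        using card_mono[OF _ sub] finR by (simp add: card_cartesian_product)
      then have prod: "sylow_order G p * sylow_order H p \<le> card ?A * card ?B"
        using cR so by simp
      have cA: "card ?A = sylow_order G p"
        using prod le pos by (metis le_antisym mult_le_cancel2 mult_le_mono2 order_trans)
      have cB: "card ?B = sylow_order H p"
        using prod le pos by (metis le_antisym mult_le_cancel1 mult_le_mono1 order_trans)
      have "R = ?A \<times> ?B"
        using sub finR cA cB cR so by (intro card_subset_eq) (auto simp: card_cartesian_product)
      then show "R \<in> ?L"
        using A B cA cB by (auto simp: sylow_subgroups_def intro!: image_eqI[of R _ "(?A, ?B)"])
    qed
  qed
  from bij_betw_same_card[OF this] show ?thesis
    by (simp add: sylow_number_def card_cartesian_product)
qed

section \<open>The Sylow numbers of the alternating group of degree 5\<close>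

text \<open>The counts in \<open>A\<^sub>5\<close> are found by rewriting.  A permutation of \<open>{1..5}\<close> is stored as the word of
  its five values, over a type with five constructors: then an entry is looked up, and two entries
  are compared, in a single rewrite step, which numerals would not allow.\<close>
datatype point = P1 | P2 | P3 | P4 | P5

datatype word = Word point point point point point

fun entry :: "word \<Rightarrow> point \<Rightarrow> point" where
  "entry (Word a b c d e) P1 = a"
| "entry (Word a b c d e) P2 = b"
| "entry (Word a b c d e) P3 = c"
| "entry (Word a b c d e) P4 = d"
| "entry (Word a b c d e) P5 = e"

fun mult_word :: "word \<Rightarrow> word \<Rightarrow> word" where
  "mult_word u (Word a b c d e) =
     Word (entry u a) (entry u b) (entry u c) (entry u d) (entry u e)"

definition id_word :: word where
  "id_word = Word P1 P2 P3 P4 P5"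

primrec power_word :: "word \<Rightarrow> nat \<Rightarrow> word" where
  "power_word u 0 = id_word"
| "power_word u (Suc n) = mult_word (power_word u n) u"

definition points :: "point list" where
  "points = [P1, P2, P3, P4, P5]"

definition permutation_words :: "word list" where
  "permutation_words =
     [Word a b c d e.
        a \<leftarrow> points,
        b \<leftarrow> removeAll a points,
        c \<leftarrow> removeAll a (removeAll b points),
        d \<leftarrow> removeAll a (removeAll b (removeAll c points)),
        e \<leftarrow> removeAll a (removeAll b (removeAll c (removeAll d points)))]"

lemma set_points: "set points = UNIV"
proof -
  have "x \<in> set points" for x by (cases x) (simp_all add: points_def)
  then show ?thesis by blast
qed

lemma distinct_imp_in_permutation_words:
  assumes "distinct [a, b, c, d, e]"
  shows "Word a b c d e \<in> set permutation_words"
  unfolding permutation_words_def set_concat set_map image_image set_removeAll set_points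
  using assms by (intro UN_I[of a] UN_I[of b] UN_I[of c] UN_I[of d] UN_I[of e]) auto

text \<open>The words of the permutations \<open>p\<^sup>2\<close>.  Squares are even, and every even permutation of five points
  is a square: cycles of length 3 and 5 have odd order, and a product of two disjoint
  transpositions is the square of a 4-cycle.  So this is a list of \<open>A\<^sub>5\<close> that needs no computation of
  signs.\<close>
definition square_words :: "word list" where
  "square_words = remdups (map (\<lambda>w. mult_word w w) permutation_words)"

lemma length_permutation_words: "length permutation_words = 120"
  by code_simp

lemma length_square_words: "length square_words = 60"
  by code_simp

definition torsion_words :: "nat \<Rightarrow> word list" where
  "torsion_words q = filter (\<lambda>u. u \<noteq> id_word \<and> power_word u q = id_word) square_words"

definition centralizer_words :: "word \<Rightarrow> word list" where
  "centralizer_words u = filter (\<lambda>v. mult_word u v = mult_word v u) square_words"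

lemma length_torsion_words:
  "length (torsion_words 4) = 15" "length (torsion_words 3) = 20" "length (torsion_words 5) = 24"
  by code_simp+

text \<open>The list \<open>A\<close> is an argument in order that it is evaluated only once for all elements of \<open>X\<close>.\<close>
definition centralizer_lengths :: "word list \<Rightarrow> word list \<Rightarrow> nat list" where
  "centralizer_lengths A X = map (\<lambda>u. length (filter (\<lambda>v. mult_word u v = mult_word v u) A)) X"

lemma length_centralizer_words:
  assumes "q \<in> {3, 4, 5}" "u \<in> set (torsion_words q)"
  shows "length (centralizer_words u) = q"
proof -
  have "list_all (\<lambda>q. list_all (\<lambda>k. k = q) (centralizer_lengths square_words (torsion_words q)))
          [3, 4, 5]"
    by code_simp
  then show ?thesis
    using assms by (auto simp: list_all_iff centralizer_lengths_def centralizer_words_def)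
qed

definition point_of :: "nat \<Rightarrow> point" where
  "point_of i = (if i = 1 then P1 else if i = 2 then P2 else if i = 3 then P3
     else if i = 4 then P4 else P5)"

definition word_of :: "(nat \<Rightarrow> nat) \<Rightarrow> word" where
  "word_of p = Word (point_of (p 1)) (point_of (p 2)) (point_of (p 3)) (point_of (p 4))
     (point_of (p 5))"

lemma in_1_5_iff: "i \<in> {1..5} \<longleftrightarrow> i = 1 \<or> i = 2 \<or> i = 3 \<or> i = 4 \<or> i = (5::nat)"
  by auto

lemma inj_on_point_of: "inj_on point_of {1..5}"
  unfolding inj_on_def in_1_5_iff by (auto simp: point_of_def)

lemma entry_word_of: "i \<in> {1..5} \<Longrightarrow> entry (word_of p) (point_of i) = point_of (p i)"
  unfolding in_1_5_iff by (auto simp: point_of_def word_of_def)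

lemma word_of_comp:
  assumes "q permutes {1..5}"
  shows "word_of (p \<circ> q) = mult_word (word_of p) (word_of q)"
proof -
  have "q i \<in> {1..5}" if "i \<in> {1..5}" for i
    using that permutes_in_image[OF assms] by blast
  then have "entry (word_of p) (point_of (q i)) = point_of (p (q i))" if "i \<in> {1..5}" for i
    using that by (intro entry_word_of) blast
  then show ?thesis
    unfolding word_of_def[of q] word_of_def[of "p \<circ> q"] by simp
qed

lemma inj_on_word_of: "inj_on word_of {p. p permutes {1..5}}"
proof (rule inj_onI)
  fix p q assume "p \<in> {p. p permutes {1..5}}" "q \<in> {p. p permutes {1..5}}"
    and eq: "word_of p = word_of q"
  then have p: "p permutes {1..5}" and q: "q permutes {1..5}" by auto
  show "p = q"
  proof
    fix i
    show "p i = q i"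
    proof (cases "i \<in> {1..5}")
      case True
      then have "point_of (p i) = point_of (q i)"
        using entry_word_of[of i p] entry_word_of[of i q] eq by simp
      then show ?thesis
        using inj_onD[OF inj_on_point_of] True permutes_in_image[OF p] permutes_in_image[OF q]
        by blast
    next
      case False
      then show ?thesis
        using permutes_not_in[OF p] permutes_not_in[OF q] by simp
    qed
  qed
qed

text \<open>Both sets have at most 120 elements and the image has exactly that many, so the inclusion is an
  equality.\<close>
lemma word_of_permutes: "word_of ` {p. p permutes {1..5}} = set permutation_words"
proof (rule card_subset_eq)
  show sub: "word_of ` {p. p permutes {1..5}} \<subseteq> set permutation_words"
  proof safe
    fix p :: "nat \<Rightarrow> nat" assume p: "p permutes {1..5}"
    have "inj_on (point_of \<circ> p) {1..5}"
      using p inj_on_point_of permutes_inj_on[OF p] permutes_image[OF p]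
      by (intro comp_inj_on) simp_all
    then have ne: "point_of (p i) \<noteq> point_of (p j)" if "i \<in> {1..5}" "j \<in> {1..5}" "i \<noteq> j" for i j
      using that by (auto simp: inj_on_def)
    show "word_of p \<in> set permutation_words"
      using ne[of 1 2] ne[of 1 3] ne[of 1 4] ne[of 1 5] ne[of 2 3] ne[of 2 4] ne[of 2 5]
        ne[of 3 4] ne[of 3 5] ne[of 4 5]
      unfolding word_of_def by (intro distinct_imp_in_permutation_words) simp
  qed
  have "card (word_of ` {p. p permutes {1..5}}) = card {p. p permutes {1..5::nat}}"
    by (rule card_image[OF inj_on_word_of])
  also have "\<dots> = 120"
    by (subst card_permutations[of _ 5]) (simp_all add: fact_numeral)
  finally have c: "card (word_of ` {p. p permutes {1..5}}) = 120" .
  moreover have "card (set permutation_words) \<le> 120"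
    using card_length[of permutation_words] by (simp add: length_permutation_words)
  ultimately show "card (word_of ` {p. p permutes {1..5}}) = card (set permutation_words)"
    using card_mono[OF _ sub] by simp
qed simp

lemma order_alt_group_5: "Coset.order (alt_group 5) = 60"
  using alt_group_card_carrier[of 5] by (simp add: Coset.order_def fact_numeral)

text \<open>Every square is an even permutation, and there are as many squares as even permutations, namely
  60.\<close>
lemma bij_betw_word_of: "bij_betw word_of (carrier (alt_group 5)) (set square_words)"
proof -
  have inj: "inj_on word_of (carrier (alt_group 5))"
    by (rule inj_on_subset[OF inj_on_word_of]) (auto simp: alt_group_carrier)
  have "set square_words = word_of ` carrier (alt_group 5)"
  proof (rule card_subset_eq)
    show "finite (word_of ` carrier (alt_group 5))"
      using order_alt_group_5 by (intro finite_imageI card_ge_0_finite) (simp add: Coset.order_def)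
    show "set square_words \<subseteq> word_of ` carrier (alt_group 5)"
    proof
      fix w assume "w \<in> set square_words"
      then obtain v where "v \<in> set permutation_words" and w: "w = mult_word v v"
        by (auto simp: square_words_def)
      then obtain p where p: "p permutes {1..5}" and v: "v = word_of p"
        using word_of_permutes by blast
      have "permutation p" using p by (metis finite_atLeastAtMost permutation_permutes)
      then have "p \<circ> p \<in> carrier (alt_group 5)"
        using p by (simp add: alt_group_carrier permutes_compose evenperm_comp)
      moreover have "w = word_of (p \<circ> p)"
        using w v word_of_comp[OF p] by simp
      ultimately show "w \<in> word_of ` carrier (alt_group 5)" by blast
    qed
    have "distinct square_words" by (simp add: square_words_def)
    then have "card (set square_words) = 60"
      using distinct_card[of square_words] length_square_words by simp
    then show "card (set square_words) = card (word_of ` carrier (alt_group 5))"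
      using order_alt_group_5 card_image[OF inj] by (simp add: Coset.order_def)
  qed
  with inj show ?thesis by (simp add: bij_betw_def)
qed

lemma card_alt_group_5_filter:
  "card {x \<in> carrier (alt_group 5). P (word_of x)} = length (filter P square_words)"
proof -
  have "bij_betw word_of {x \<in> carrier (alt_group 5). P (word_of x)} (set (filter P square_words))"
    using bij_betw_word_of by (auto simp: bij_betw_def inj_on_def)
  moreover have "distinct (filter P square_words)"
    by (simp add: square_words_def)
  ultimately show ?thesis
    by (simp only: bij_betw_same_card distinct_card)
qed

lemma word_of_id: "word_of id = id_word"
  by (simp add: word_of_def id_word_def point_of_def)

lemma word_of_eq_iff:
  assumes "x \<in> carrier (alt_group 5)" "y \<in> carrier (alt_group 5)"
  shows "word_of x = word_of y \<longleftrightarrow> x = y"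
  using assms inj_on_eq_iff[OF inj_on_word_of] by (simp add: alt_group_carrier)

lemma word_of_mult:
  assumes "x \<in> carrier (alt_group 5)" "y \<in> carrier (alt_group 5)"
  shows "word_of (x \<otimes>\<^bsub>alt_group 5\<^esub> y) = mult_word (word_of x) (word_of y)"
  using assms by (simp add: alt_group_mult word_of_comp alt_group_carrier)

lemma word_of_pow:
  assumes "x \<in> carrier (alt_group 5)"
  shows "word_of (x [^]\<^bsub>alt_group 5\<^esub> (n::nat)) = power_word (word_of x) n"
proof -
  interpret A5: group "alt_group 5" by (rule alt_group_is_group)
  show ?thesis
    using assms by (induction n) (simp_all add: word_of_mult alt_group_one word_of_id)
qed

text \<open>In \<open>A\<^sub>5\<close> the elements of order 2, 3 and 5 have centralizers of order 4, 3 and 5, and no element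
  has order 4; so each of these subgroup orders can be treated by counting centralizers.\<close>
lemma card_subgroups_alt_group_5:
  assumes q: "q \<in> {3, 4, 5}"
  shows "(q - 1) * card {H. subgroup H (alt_group 5) \<and> card H = q} = length (torsion_words q)"
proof -
  interpret A5: group "alt_group 5" by (rule alt_group_is_group)
  have word_one: "word_of x = id_word \<longleftrightarrow> x = \<one>\<^bsub>alt_group 5\<^esub>"
    if "x \<in> carrier (alt_group 5)" for x
    using word_of_eq_iff[OF that A5.one_closed] by (simp add: alt_group_one word_of_id)
  have torsion: "x \<noteq> \<one>\<^bsub>alt_group 5\<^esub> \<and> x [^]\<^bsub>alt_group 5\<^esub> q = \<one>\<^bsub>alt_group 5\<^esub> \<longleftrightarrow>
      word_of x \<noteq> id_word \<and> power_word (word_of x) q = id_word"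
    if "x \<in> carrier (alt_group 5)" for x
    using that by (simp add: word_one flip: word_of_pow)
  have "(q - 1) * card {H. subgroup H (alt_group 5) \<and> card H = q} =
      card {x \<in> carrier (alt_group 5). x \<noteq> \<one>\<^bsub>alt_group 5\<^esub> \<and> x [^]\<^bsub>alt_group 5\<^esub> q = \<one>\<^bsub>alt_group 5\<^esub>}"
  proof (rule A5.card_subgroups_via_centralizers)
    show "finite (carrier (alt_group 5))"
      using order_alt_group_5 by (intro card_ge_0_finite) (simp add: Coset.order_def)
  next
    fix H x y assume H: "subgroup H (alt_group 5)" "card H = q" and xy: "x \<in> H" "y \<in> H"
    interpret H: group "alt_group 5\<lparr>carrier := H\<rparr>"
      by (rule subgroup.subgroup_is_group[OF H(1) A5.is_group])
    have "finite H" using H(2) q by (intro card_ge_0_finite) auto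
    then show "x \<otimes>\<^bsub>alt_group 5\<^esub> y = y \<otimes>\<^bsub>alt_group 5\<^esub> x"
      using H.commute_of_order_le_5[of x y] H(2) xy q by (auto simp: Coset.order_def)
  next
    fix x assume x: "x \<in> carrier (alt_group 5)" "x \<noteq> \<one>\<^bsub>alt_group 5\<^esub>"
      "x [^]\<^bsub>alt_group 5\<^esub> q = \<one>\<^bsub>alt_group 5\<^esub>"
    have "word_of x \<in> set square_words"
      using bij_betwE[OF bij_betw_word_of] x(1) by blast
    then have "word_of x \<in> set (torsion_words q)"
      using torsion[OF x(1)] x by (simp add: torsion_words_def)
    then have "length (centralizer_words (word_of x)) = q"
      by (rule length_centralizer_words[OF q])
    moreover have "{y \<in> carrier (alt_group 5). x \<otimes>\<^bsub>alt_group 5\<^esub> y = y \<otimes>\<^bsub>alt_group 5\<^esub> x} =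
        {y \<in> carrier (alt_group 5). mult_word (word_of x) (word_of y) = mult_word (word_of y) (word_of x)}"
      using x(1) by (auto simp: word_of_eq_iff simp flip: word_of_mult)
    ultimately show "card {y \<in> carrier (alt_group 5). x \<otimes>\<^bsub>alt_group 5\<^esub> y = y \<otimes>\<^bsub>alt_group 5\<^esub> x} = q"
      using card_alt_group_5_filter[of "\<lambda>v. mult_word (word_of x) v = mult_word v (word_of x)"]
      by (simp add: centralizer_words_def)
  qed
  also have "{x \<in> carrier (alt_group 5). x \<noteq> \<one>\<^bsub>alt_group 5\<^esub> \<and> x [^]\<^bsub>alt_group 5\<^esub> q = \<one>\<^bsub>alt_group 5\<^esub>} =
      {x \<in> carrier (alt_group 5). word_of x \<noteq> id_word \<and> power_word (word_of x) q = id_word}"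
    using torsion by blast
  also have "card \<dots> = length (torsion_words q)"
    unfolding torsion_words_def by (rule card_alt_group_5_filter)
  finally show ?thesis .
qed

lemma sylow_order_alt_group_5:
  "sylow_order (alt_group 5) 2 = 4" "sylow_order (alt_group 5) 3 = 3"
  "sylow_order (alt_group 5) 5 = 5"
proof -
  have "multiplicity 2 (60::nat) = 2" "multiplicity 3 (60::nat) = 1" "multiplicity 5 (60::nat) = 1"
    by (rule multiplicity_eqI; simp)+
  then show "sylow_order (alt_group 5) 2 = 4" "sylow_order (alt_group 5) 3 = 3"
    "sylow_order (alt_group 5) 5 = 5"
    by (simp_all add: sylow_order_def order_alt_group_5)
qed

lemma sylow_number_alt_group_5:
  "sylow_number (alt_group 5) 2 = 5" "sylow_number (alt_group 5) 3 = 10"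
  "sylow_number (alt_group 5) 5 = 6"
  using card_subgroups_alt_group_5[of 4] card_subgroups_alt_group_5[of 3]
    card_subgroups_alt_group_5[of 5]
  by (simp_all add: sylow_number_def sylow_subgroups_def sylow_order_alt_group_5 length_torsion_words)

section \<open>The invariant of the product\<close>

definition C2_prod :: "nat set \<Rightarrow> (int \<times> (nat \<Rightarrow> int)) monoid" where
  "C2_prod Q = integer_mod_group 2 \<times>\<times> product_group Q integer_mod_group"

lemma comm_group_C2_prod: "comm_group (C2_prod Q)"
proof (rule group.group_comm_groupI)
  show "group (C2_prod Q)"
    unfolding C2_prod_def by (intro DirProd_group product_group) auto
qed (auto simp: C2_prod_def add.commute)

lemma order_C2_prod:
  assumes "finite Q" "\<And>q. q \<in> Q \<Longrightarrow> q > 0"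
  shows "Coset.order (C2_prod Q) = 2 * \<Prod>Q"
proof -
  have "card (carrier (integer_mod_group n)) = n" if "n > 0" for n
    using that by (simp add: carrier_integer_mod_group)
  then show ?thesis
    using assms by (simp add: C2_prod_def Coset.order_def card_cartesian_product card_PiE)
qed

lemma not_dvd_prod_primes:
  fixes p :: nat
  assumes "finite Q" "prime p" "\<And>q. q \<in> Q \<Longrightarrow> prime q" "p \<notin> Q"
  shows "\<not> p dvd \<Prod>Q"
proof
  assume "p dvd \<Prod>Q"
  then obtain q where q: "q \<in> Q" "p dvd q"
    using assms(1,2) by (auto simp: prime_dvd_prod_iff)
  then have "p = q" by (intro primes_dvd_imp_eq assms)
  with q assms(4) show False by simp
qed

text \<open>The abelian factor has no effect on the Sylow numbers; it doubles the order of the Sylow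
  2-subgroup and contributes one Sylow subgroup of order \<open>q\<close> for each \<open>q \<in> Q\<close>.  The primes 2, 3, 5
  give \<open>5/9 + 10/4 + 6/6 = 73/18\<close>.\<close>
lemma sylow_gamma_A5_C2_prod:
  assumes fin: "finite Q" and prime: "\<And>q. q \<in> Q \<Longrightarrow> prime q" and gt: "\<And>q. q \<in> Q \<Longrightarrow> q > 5"
  shows "sylow_gamma (A5_C2_prod Q) = 73 / 18 + (\<Sum>q\<in>Q. 1 / (real q + 1))"
proof -
  let ?A = "alt_group 5" and ?B = "C2_prod Q" and ?G = "A5_C2_prod Q"
  have G: "?G = ?A \<times>\<times> ?B" by (simp add: A5_C2_prod_def C2_prod_def)
  interpret A: group ?A by (rule alt_group_is_group)
  interpret B: comm_group ?B by (rule comm_group_C2_prod)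
  have pos: "q > 0" if "q \<in> Q" for q using prime[OF that] by (rule prime_gt_0_nat)
  have oB: "Coset.order ?B = 2 * \<Prod>Q" using order_C2_prod[OF fin] pos by blast
  have prod_pos: "\<Prod>Q > 0" using pos by (simp add: prod_pos)
  have fA: "finite (carrier ?A)" and fB: "finite (carrier ?B)"
    using A.order_gt_0_iff_finite B.order_gt_0_iff_finite prod_pos
    by (simp_all add: order_alt_group_5 oB)
  have p235: "prime (2::nat)" "prime (3::nat)" "prime (5::nat)" by simp_all
  have notin: "2 \<notin> Q" "3 \<notin> Q" "5 \<notin> Q" using gt by force+
  have dvd60: "p dvd 60 \<longleftrightarrow> p \<in> {2, 3, 5}" if "prime p" for p :: nat
  proof -
    have "p dvd 60 \<longleftrightarrow> p dvd 2 * (2 * (3 * 5))" by simp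
    also have "\<dots> \<longleftrightarrow> p dvd 2 \<or> p dvd 3 \<or> p dvd 5"
      using that by (simp only: prime_dvd_mult_iff) blast
    also have "\<dots> \<longleftrightarrow> p \<in> {2, 3, 5}"
      using p235[THEN primes_dvd_imp_eq[OF that]] by auto
    finally show ?thesis .
  qed
  have dvdB: "p dvd 2 * \<Prod>Q \<longleftrightarrow> p = 2 \<or> p \<in> Q" if "prime p" for p
    using that p235 not_dvd_prod_primes[OF fin that prime] dvd_prodI[OF fin, of p "\<lambda>x. x"]
      primes_dvd_imp_eq[OF that p235(1)]
    by (auto simp: prime_dvd_mult_iff)
  have "p dvd Coset.order ?G \<longleftrightarrow> p \<in> {2, 3, 5} \<union> Q" if "prime p" for p
  proof -
    have "p dvd Coset.order ?G \<longleftrightarrow> p dvd 60 \<or> p dvd 2 * \<Prod>Q"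
      unfolding G order_DirProd order_alt_group_5 oB by (rule prime_dvd_mult_iff[OF that])
    then show ?thesis using dvd60[OF that] dvdB[OF that] by blast
  qed
  then have divisors: "prime_divisors_of_order ?G = {2, 3, 5} \<union> Q"
    using p235 prime by (auto simp: prime_divisors_of_order_def)
  have number: "sylow_number ?G p = sylow_number ?A p" if "prime p" for p
    unfolding G
    using sylow_number_DirProd[OF A.is_group fA B.is_group fB that]
      B.sylow_number_comm_group[OF fB that] by simp
  have so: "sylow_order ?G p = sylow_order ?A p * sylow_order ?B p" if "prime p" for p
    unfolding G by (rule sylow_order_DirProd[OF A.is_group fA B.is_group fB that])
  have so2: "sylow_order ?B 2 = 2"
  proof -
    have "multiplicity 2 (2 * \<Prod>Q) = 1"
      using not_dvd_prod_primes[OF fin p235(1) prime notin(1)]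
      by (intro multiplicity_eqI) auto
    then show ?thesis by (simp add: sylow_order_def oB)
  qed
  have soQ: "sylow_order ?B q = q" if q: "q \<in> Q" for q
  proof -
    have "\<Prod>Q = q * \<Prod>(Q - {q})" using prod.remove[OF fin q, of "\<lambda>x. x"] .
    moreover have "\<not> q dvd \<Prod>(Q - {q})"
      using fin prime q by (intro not_dvd_prod_primes) auto
    moreover have "\<not> q dvd 2" using gt[OF q] by (auto dest: dvd_imp_le)
    ultimately have "multiplicity q (2 * \<Prod>Q) = 1"
      using prime[OF q] pos[OF q] by (intro multiplicity_eqI) (auto simp: prime_dvd_mult_iff)
    then show ?thesis by (simp add: sylow_order_def oB)
  qed
  have so35: "sylow_order ?B 3 = 1" "sylow_order ?B 5 = 1"
  proof -
    have "\<not> 3 dvd Coset.order ?B" "\<not> 5 dvd Coset.order ?B"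
      unfolding oB using dvdB[OF p235(2)] dvdB[OF p235(3)] notin by simp_all
    then show "sylow_order ?B 3 = 1" "sylow_order ?B 5 = 1"
      by (blast intro: sylow_order_not_dvd)+
  qed
  let ?t = "\<lambda>p. real (sylow_number ?G p) / (real (sylow_order ?G p) + 1)"
  have tQ: "?t q = 1 / (real q + 1)" if q: "q \<in> Q" for q
  proof -
    have "q \<notin> {2, 3, 5}" using gt[OF q] by auto
    then have "\<not> q dvd Coset.order ?A"
      using dvd60[OF prime[OF q]] by (simp add: order_alt_group_5)
    from A.sylow_number_not_dvd[OF this] sylow_order_not_dvd[OF this] show ?thesis
      by (simp add: number so soQ prime q)
  qed
  have "sylow_gamma ?G = (\<Sum>p\<in>{2, 3, 5} \<union> Q. ?t p)"
    by (simp only: sylow_gamma_eq_sum divisors)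
  also have "\<dots> = (\<Sum>p\<in>{2, 3, 5}. ?t p) + (\<Sum>q\<in>Q. ?t q)"
    using fin notin by (intro sum.union_disjoint) auto
  also have "(\<Sum>q\<in>Q. ?t q) = (\<Sum>q\<in>Q. 1 / (real q + 1))"
    by (rule sum.cong[OF refl tQ])
  also have "(\<Sum>p\<in>{2, 3, 5}. ?t p) = 73 / 18"
    by (simp add: number so so2 so35 sylow_order_alt_group_5 sylow_number_alt_group_5)
  finally show ?thesis .
qed

text \<open>The projection onto the unsolvable group \<open>A\<^sub>5\<close> shows that the product is not solvable; it is not
  isomorphic to \<open>A\<^sub>5\<close> because its order is larger.\<close>
lemma A5_C2_prod_properties:
  assumes fin: "finite Q" and pos: "\<And>q. q \<in> Q \<Longrightarrow> q > 0"
  shows "group (A5_C2_prod Q)" "finite (carrier (A5_C2_prod Q))"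
    "\<not> solvable (A5_C2_prod Q)" "\<not> A5_C2_prod Q \<cong> alt_group 5"
proof -
  let ?A = "alt_group 5" and ?B = "C2_prod Q" and ?G = "A5_C2_prod Q"
  have G: "?G = ?A \<times>\<times> ?B" by (simp add: A5_C2_prod_def C2_prod_def)
  interpret A: group ?A by (rule alt_group_is_group)
  interpret B: comm_group ?B by (rule comm_group_C2_prod)
  have "group (?A \<times>\<times> ?B)" by (rule DirProd_group[OF A.is_group B.is_group])
  then show grp: "group ?G" by (simp only: G)
  have o: "Coset.order ?G = 120 * \<Prod>Q"
    by (simp add: G order_DirProd order_alt_group_5 order_C2_prod[OF fin pos])
  have prod_pos: "\<Prod>Q > 0" using pos by (simp add: prod_pos)
  then show "finite (carrier ?G)"
    using monoid.order_gt_0_iff_finite[OF group.is_monoid[OF grp]] o by simp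
  have "group_hom ?G ?A fst"
    using grp A.is_group by (auto simp: G group_hom_def group_hom_axioms_def hom_def)
  moreover have "fst ` carrier ?G = carrier ?A"
    using B.one_closed by (force simp: G)
  ultimately show "\<not> solvable ?G"
    using group_hom.surj_hom_imp_solvable[of ?G ?A fst] alt_group_is_unsolvable[of 5] by auto
  show "\<not> ?G \<cong> ?A"
  proof
    assume "?G \<cong> ?A"
    then have "Coset.order ?G = Coset.order ?A"
      unfolding Coset.order_def by (rule iso_same_card)
    with o prod_pos show False by (simp add: order_alt_group_5)
  qed
qed

lemma prime_by_trial_division:
  fixes n m :: nat
  assumes "1 < n" "n < m * m" "list_all (\<lambda>d. \<not> d dvd n) [2..<m]"
  shows "prime n"
proof -
  have none: "\<not> d dvd n" if "1 < d" "d < m" for d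
    using assms(3) that by (auto simp: list_all_iff)
  have "d = 1 \<or> d = n" if d: "d dvd n" for d
  proof (rule ccontr)
    assume "\<not> (d = 1 \<or> d = n)"
    obtain e where n: "n = d * e" using d by (rule dvdE)
    have "d > 1" "e > 1"
      using \<open>1 < n\<close> n \<open>\<not> (d = 1 \<or> d = n)\<close> by (cases d; cases e; force)+
    then have "m \<le> d" "m \<le> e"
      using none[of d] none[of e] n by (force simp: not_less)+
    then have "m * m \<le> n" unfolding n by (rule mult_le_mono)
    with assms(2) show False by simp
  qed
  with \<open>1 < n\<close> show ?thesis by (auto simp: prime_nat_iff)
qed

theorem proposition5p2:
  fixes Q :: "nat \<Rightarrow> nat set"
  assumes "Q 1 = {7, 11, 13, 17, 19, 29, 71, 83}"
    and "Q 2 = {7, 11, 13, 17, 19, 23, 83, 179}"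
    and "Q 3 = {7, 11, 13, 17, 19, 29, 41, 503}"
    and "Q 4 = {7, 11, 13, 17, 19, 23, 59, 1259}"
  shows "(\<forall>i\<in>{1..4}. (\<forall>q\<in>Q i. prime q) \<and> (\<Sum>q\<in>Q i. 1 / (real q + 1)) = 4 / 9) \<and>
    (\<forall>i\<in>{1..4}.
       group (A5_C2_prod (Q i)) \<and>
       finite (carrier (A5_C2_prod (Q i))) \<and>
       \<not> solvable (A5_C2_prod (Q i)) \<and>
       \<not> A5_C2_prod (Q i) \<cong> alt_group 5 \<and>
       sylow_gamma (A5_C2_prod (Q i)) = 9 / 2)"
proof -
  have i: "i = 1 \<or> i = 2 \<or> i = 3 \<or> i = 4" if "i \<in> {1..4}" for i :: nat
    using that by auto
  have fin: "finite (Q i)" and gt: "\<And>q. q \<in> Q i \<Longrightarrow> q > 5"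
    and sum: "(\<Sum>q\<in>Q i. 1 / (real q + 1)) = 4 / 9" if "i \<in> {1..4}" for i
    using i[OF that] assms by auto
  \<comment> \<open>A bound \<open>m\<close> for the trial divisors needs \<open>m\<^sup>2\<close> above the primes in question and \<open>m\<close> not above them,
    hence three ranges; the last one uses \<open>36\<^sup>2 = 1296 > 1259\<close>.\<close>
  have "prime (7::nat)" "prime (11::nat)" "prime (13::nat)" "prime (17::nat)" "prime (19::nat)"
    "prime (23::nat)" "prime (29::nat)"
    by (rule prime_by_trial_division[of _ 6]; simp)+
  moreover have "prime (41::nat)" "prime (59::nat)" "prime (71::nat)" "prime (83::nat)"
    by (rule prime_by_trial_division[of _ 10]; simp)+
  moreover have "prime (179::nat)" "prime (503::nat)" "prime (1259::nat)"
    by (rule prime_by_trial_division[of _ 36]; simp)+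
  ultimately have "\<forall>q\<in>Q 1 \<union> Q 2 \<union> Q 3 \<union> Q 4. prime q"
    unfolding assms by (simp only: ball_Un ball_simps simp_thms)
  then have prime: "prime q" if "i \<in> {1..4}" "q \<in> Q i" for i q
    using i[OF that(1)] that(2) by blast
  have "sylow_gamma (A5_C2_prod (Q i)) = 9 / 2" if "i \<in> {1..4}" for i
    using sylow_gamma_A5_C2_prod[OF fin prime gt, of i] sum[of i] that by simp
  moreover have "\<And>q. q \<in> Q i \<Longrightarrow> q > 0" if "i \<in> {1..4}" for i
    using gt[OF that] by force
  ultimately show ?thesis
    using A5_C2_prod_properties[OF fin] prime sum by blast
qed

end
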